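(* Let $\langle S,T\rangle$ be a Rec program with $n$ procedure declarations $m_1\,\{S_{m_1}\},\dots,m_n\,\{S_{m_n}\}$ in $T$, let $\phi_{m}=\mu X_m.\,\mathsf{stf}_{\{m\}}(S_m)$ for each declared $m$, and let $\Gamma=\{Y_{m_1}:\phi_{m_1},\dots,Y_{m_n}:\phi_{m_n}\}$. Then the sequent $\Gamma\vdash S[\mathbf{skip};Y_{m_1}/m_1(),\dots,\mathbf{skip};Y_{m_n}/m_n()]:\mathsf{stf}(S)$ is derivable in the proof calculus.
   Context: Rec statements: $S ::= \mathbf{skip} \mid x := a \mid S_1;S_2 \mid \mathbf{if}\ b\ \mathbf{then}\ S_1\ \mathbf{else}\ S_2 \mid m() \mid Y$, with $a$, $b$ side-effect-free arithmetic/Boolean expressions over global integer variables, $m$ a procedure declared in $T$ (a list of declarations $m\,\{S_m\}$ of parameterless procedures, unique names, only declared ones called), and $Y$ statement variables; each procedure $m$ has an associated unique statement variable $Y_m$. $S[\mathbf{skip};Y_{m_i}/m_i()]$ replaces every call $m_i()$ by $\mathbf{skip};Y_{m_i}$. Trace formulas: $\phi ::= p \mid R \mid X \mid \phi_1\wedge\phi_2 \mid \phi_1\vee\phi_2 \mid \phi_1\frown\phi_2 \mid \mu X.\phi$ over state formulas $p$ (including Boolean expressions), binary relation symbols $R$ (including $\mathit{Id}$: $s'=s$, and $\mathit{Sb}^a_x$: $s'=s[x\mapsto\mathcal{A}[\![a]\!](s)]$) and recursion variables $X$, with semantics in $2^{\mathbf{State}^+}$: $[\![p]\!]=\{s\cdot\sigma:s\models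 p\}$, $[\![R]\!]=\{s\cdot s':R(s,s')\}$, $\wedge,\vee$ as $\cap,\cup$, $[\![\phi_1\frown\phi_2]\!]=\{\sigma_1\cdot s\cdot\sigma_2:\sigma_1\cdot s\in[\![\phi_1]\!],s\cdot\sigma_2\in[\![\phi_2]\!]\}$, $\mu$ as least fixed point; $\phi'\models\phi$ iff $[\![\phi']\!]\subseteq[\![\phi]\!]$. Strongest trace formula $\mathsf{stf}(S)=\mathsf{stf}_\varnothing(S)$: $\mathsf{stf}_{\overline{X}}(\mathbf{skip})=\mathit{Id}$, $\mathsf{stf}_{\overline{X}}(x:=a)=\mathit{Sb}^a_x$, $\mathsf{stf}_{\overline{X}}(S_1;S_2)=\mathsf{stf}_{\overline{X}}(S_1)\frown\mathsf{stf}_{\overline{X}}(S_2)$, $\mathsf{stf}_{\overline{X}}(\mathbf{if}\ b\ \mathbf{then}\ S_1\ \mathbf{else}\ S_2)=(b\wedge(\mathit{Id}\frown\mathsf{stf}_{\overline{X}}(S_1)))\vee(\neg b\wedge(\mathit{Id}\frown\mathsf{stf}_{\overline{X}}(S_2)))$, $\mathsf{stf}_{\overline{X}}(m())=\mathit{Id}\frown\mu X_m.\,\mathsf{stf}_{\overline{X}\cup\{m\}}(S_m)$ if $m\notin\overline{X}$, else $\mathit{Id}\frown X_m$. Proof calculus: sequents $\Gamma\vdash S:\phi$ ($\Gamma$ a finite set of judgments $S':\phi'$, $\phi$ closed). Rules: (Skip) $\Gamma\vdash\mathbf{skip}:\mathit{Id}$; (Assign) $\Gamma\vdash x:=a:\mathit{Sb}^a_x$;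 (Seq) from $\Gamma\vdash S_1:\phi_1$, $\Gamma\vdash S_2:\phi_2$ infer $\Gamma\vdash S_1;S_2:\phi_1\frown\phi_2$; (If) from $\Gamma\vdash\mathbf{skip};S_1:\neg b\vee\phi$ and $\Gamma\vdash\mathbf{skip};S_2:b\vee\phi$ infer $\Gamma\vdash\mathbf{if}\ b\ \mathbf{then}\ S_1\ \mathbf{else}\ S_2:\phi$; (Unfold) from $\Gamma\vdash S:\phi[\mu X.\phi/X]$ infer $\Gamma\vdash S:\mu X.\phi$; (Cons) from $\Gamma\vdash S:\phi'$ infer $\Gamma\vdash S:\phi$ when $\phi'\models\phi$ (entailment supplied by an oracle); (Call) if $Y_m:\phi_m\notin\Gamma$ and $m\,\{S_m\}\in T$, from $\Gamma,Y_m:\phi_m\vdash S_m[\mathbf{skip};Y_m/m(),\mathbf{skip};Y_{m_1}/m_1(),\dots]:\phi_m$ (substituting for all procedures $m_i$ with $Y_{m_i}:\phi_{m_i}\in\Gamma$) infer $\Gamma\vdash m():\mathit{Id}\frown\phi_m$; plus standard Gentzen-style logical rules including the axiom $\Gamma\vdash S:\phi$ for $S:\phi\in\Gamma$. *)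

theory Defs
  imports Main
begin

section \<open>Programs\<close>

type_synonym vname = string
type_synonym pname = string
type_synonym svar = string
type_synonym rvar = string
type_synonym state = "vname \<Rightarrow> int"

text \<open>
  The expression language is left open in the mathematics, apart from being side-effect-free
  and over integer variables. Binary operators and comparisons are therefore arbitrary functions.
\<close>

datatype aexp = Num int | Var vname | AOp "int \<Rightarrow> int \<Rightarrow> int" aexp aexp

datatype bexp =
    BConst bool
  | BCmp "int \<Rightarrow> int \<Rightarrow> bool" aexp aexp
  | BNot bexp
  | BAnd bexp bexp
  | BOr bexp bexp

primrec aval :: "aexp \<Rightarrow> state \<Rightarrow> int" where
  "aval (Num n) s = n"
| "aval (Var x) s = s x"
| "aval (AOp f a1 a2) s = f (aval a1 s) (aval a2 s)"

primrec bval :: "bexp \<Rightarrow> state \<Rightarrow> bool" where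
  "bval (BConst v) s = v"
| "bval (BCmp r a1 a2) s = r (aval a1 s) (aval a2 s)"
| "bval (BNot b) s = (\<not> bval b s)"
| "bval (BAnd b1 b2) s = (bval b1 s \<and> bval b2 s)"
| "bval (BOr b1 b2) s = (bval b1 s \<or> bval b2 s)"

datatype stmt =
    Skip
  | Assign vname aexp
  | Seq stmt stmt
  | If bexp stmt stmt
  | Call pname
  | SVar svar

type_synonym decls = "(pname \<times> stmt) list"

abbreviation declared :: "decls \<Rightarrow> pname set" where
  "declared T \<equiv> fst ` set T"

text \<open>
  The statement variable \<open>Y\<^sub>m\<close> and the recursion variable \<open>X\<^sub>m\<close> of a procedure \<open>m\<close> carry the
  name of \<open>m\<close>; the three kinds of names live in different syntactic positions.
\<close>

definition proc_svar :: "pname \<Rightarrow> svar" where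
  "proc_svar m = m"

definition proc_rvar :: "pname \<Rightarrow> rvar" where
  "proc_rvar m = m"

primrec calls :: "stmt \<Rightarrow> pname set" where
  "calls Skip = {}"
| "calls (Assign x a) = {}"
| "calls (Seq S1 S2) = calls S1 \<union> calls S2"
| "calls (If b S1 S2) = calls S1 \<union> calls S2"
| "calls (Call m) = {m}"
| "calls (SVar Y) = {}"

primrec svars :: "stmt \<Rightarrow> svar set" where
  "svars Skip = {}"
| "svars (Assign x a) = {}"
| "svars (Seq S1 S2) = svars S1 \<union> svars S2"
| "svars (If b S1 S2) = svars S1 \<union> svars S2"
| "svars (Call m) = {}"
| "svars (SVar Y) = {Y}"

text \<open>
  Statement variables only serve the proof calculus. The source program contains none, which is
  also the domain on which the strongest trace formula is defined.
\<close>

definition rec_program :: "stmt \<Rightarrow> decls \<Rightarrow> bool" where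
  "rec_program S T \<longleftrightarrow>
     distinct (map fst T) \<and>
     (\<forall>S' \<in> insert S (snd ` set T). calls S' \<subseteq> declared T \<and> svars S' = {})"

primrec subst_calls :: "pname set \<Rightarrow> stmt \<Rightarrow> stmt" where
  "subst_calls M Skip = Skip"
| "subst_calls M (Assign x a) = Assign x a"
| "subst_calls M (Seq S1 S2) = Seq (subst_calls M S1) (subst_calls M S2)"
| "subst_calls M (If b S1 S2) = If b (subst_calls M S1) (subst_calls M S2)"
| "subst_calls M (Call m) = (if m \<in> M then Seq Skip (SVar (proc_svar m)) else Call m)"
| "subst_calls M (SVar Y) = SVar Y"


section \<open>Trace formulas\<close>

datatype sform = SBool bexp | SPred "state \<Rightarrow> bool"

datatype rsym = IdR | SbR vname aexp | RelR "state \<Rightarrow> state \<Rightarrow> bool"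

datatype tform =
    State sform
  | Rel rsym
  | RVar rvar
  | And tform tform
  | Or tform tform
  | Chop tform tform  (infixr \<open>\<frown>\<close> 75)
  | Mu rvar tform

abbreviation Bool :: "bexp \<Rightarrow> tform" where
  "Bool b \<equiv> State (SBool b)"

primrec sform_holds :: "sform \<Rightarrow> state \<Rightarrow> bool" where
  "sform_holds (SBool b) s = bval b s"
| "sform_holds (SPred p) s = p s"

primrec rsym_holds :: "rsym \<Rightarrow> state \<Rightarrow> state \<Rightarrow> bool" where
  "rsym_holds IdR s s' = (s' = s)"
| "rsym_holds (SbR x a) s s' = (s' = s(x := aval a s))"
| "rsym_holds (RelR r) s s' = r s s'"

type_synonym trace = "state list"

definition chop :: "trace set \<Rightarrow> trace set \<Rightarrow> trace set" where
  "chop A B = {\<sigma>1 @ [s] @ \<sigma>2 | \<sigma>1 s \<sigma>2. \<sigma>1 @ [s] \<in> A \<and> [s] @ \<sigma>2 \<in> B}"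

text \<open>
  Traces are nonempty. The least fixed point is taken in the lattice of all sets of lists, but
  stays inside the nonempty ones (lemma \<open>sem_nonempty\<close>).
\<close>

primrec sem :: "tform \<Rightarrow> (rvar \<Rightarrow> trace set) \<Rightarrow> trace set" where
  "sem (State p) \<rho> = {s # \<sigma> | s \<sigma>. sform_holds p s}"
| "sem (Rel r) \<rho> = {[s, s'] | s s'. rsym_holds r s s'}"
| "sem (RVar X) \<rho> = \<rho> X"
| "sem (And \<phi> \<psi>) \<rho> = sem \<phi> \<rho> \<inter> sem \<psi> \<rho>"
| "sem (Or \<phi> \<psi>) \<rho> = sem \<phi> \<rho> \<union> sem \<psi> \<rho>"
| "sem (\<phi> \<frown> \<psi>) \<rho> = chop (sem \<phi> \<rho>) (sem \<psi> \<rho>)"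
| "sem (Mu X \<phi>) \<rho> = lfp (\<lambda>U. sem \<phi> (\<rho>(X := U)))"

lemma sem_mono: "\<rho> \<le> \<rho>' \<Longrightarrow> sem \<phi> \<rho> \<subseteq> sem \<phi> \<rho>'"
proof (induction \<phi> arbitrary: \<rho> \<rho>')
  case (And \<phi> \<psi>)
  from And.IH[OF And.prems] show ?case by auto
next
  case (Or \<phi> \<psi>)
  from Or.IH[OF Or.prems] show ?case by auto
next
  case (Chop \<phi> \<psi>)
  from Chop.IH[OF Chop.prems] show ?case
    unfolding sem.simps chop_def by blast
next
  case (Mu X \<phi>)
  show ?case unfolding sem.simps
    by (rule lfp_mono, rule Mu.IH) (use Mu.prems in \<open>simp add: le_fun_def\<close>)
qed (auto simp: le_fun_def)

lemma sem_nonempty: "\<forall>X. [] \<notin> \<rho> X \<Longrightarrow> [] \<notin> sem \<phi> \<rho>"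
proof (induction \<phi> arbitrary: \<rho>)
  case (Mu X \<phi>)
  then have "[] \<notin> sem \<phi> (\<rho>(X := - {[]}))"
    by (intro Mu.IH) simp
  then have "lfp (\<lambda>U. sem \<phi> (\<rho>(X := U))) \<subseteq> - {[]}"
    by (intro lfp_lowerbound) auto
  then show ?case by auto
qed (auto simp: chop_def)

primrec fv :: "tform \<Rightarrow> rvar set" where
  "fv (State p) = {}"
| "fv (Rel r) = {}"
| "fv (RVar X) = {X}"
| "fv (And \<phi> \<psi>) = fv \<phi> \<union> fv \<psi>"
| "fv (Or \<phi> \<psi>) = fv \<phi> \<union> fv \<psi>"
| "fv (\<phi> \<frown> \<psi>) = fv \<phi> \<union> fv \<psi>"
| "fv (Mu X \<phi>) = fv \<phi> - {X}"

abbreviation closed :: "tform \<Rightarrow> bool" where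
  "closed \<phi> \<equiv> fv \<phi> = {}"

text \<open>Only used on closed formulas, whose semantics does not depend on the valuation.\<close>

definition entails :: "tform \<Rightarrow> tform \<Rightarrow> bool" where
  "entails \<phi>' \<phi> \<longleftrightarrow> (\<forall>\<rho>. sem \<phi>' \<rho> \<subseteq> sem \<phi> \<rho>)"

text \<open>Substitution of \<open>\<chi>\<close> for \<open>X\<close>. It is only used with closed \<open>\<chi>\<close>, so nothing is captured.\<close>

primrec subst :: "rvar \<Rightarrow> tform \<Rightarrow> tform \<Rightarrow> tform" where
  "subst X \<chi> (State p) = State p"
| "subst X \<chi> (Rel r) = Rel r"
| "subst X \<chi> (RVar Z) = (if Z = X then \<chi> else RVar Z)"
| "subst X \<chi> (And \<phi> \<psi>) = And (subst X \<chi> \<phi>) (subst X \<chi> \<psi>)"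
| "subst X \<chi> (Or \<phi> \<psi>) = Or (subst X \<chi> \<phi>) (subst X \<chi> \<psi>)"
| "subst X \<chi> (\<phi> \<frown> \<psi>) = subst X \<chi> \<phi> \<frown> subst X \<chi> \<psi>"
| "subst X \<chi> (Mu Z \<phi>) = Mu Z (if Z = X then \<phi> else subst X \<chi> \<phi>)"


section \<open>Strongest trace formulas\<close>

text \<open>
  The formula is left undefined on statement variables and on calls of undeclared procedures;
  neither occurs in a program.
\<close>

function stf_in :: "decls \<Rightarrow> pname set \<Rightarrow> stmt \<Rightarrow> tform" where
  "stf_in T Xs Skip = Rel IdR"
| "stf_in T Xs (Assign x a) = Rel (SbR x a)"
| "stf_in T Xs (Seq S1 S2) = stf_in T Xs S1 \<frown> stf_in T Xs S2"
| "stf_in T Xs (If b S1 S2) =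
     Or (And (Bool b) (Rel IdR \<frown> stf_in T Xs S1))
        (And (Bool (BNot b)) (Rel IdR \<frown> stf_in T Xs S2))"
| "stf_in T Xs (Call m) =
     (if m \<in> Xs then Rel IdR \<frown> RVar (proc_rvar m)
      else case map_of T m of
        None \<Rightarrow> undefined
      | Some Sm \<Rightarrow> Rel IdR \<frown> Mu (proc_rvar m) (stf_in T (insert m Xs) Sm))"
| "stf_in T Xs (SVar Y) = undefined"
  by pat_completeness auto

termination
proof (relation "measures [\<lambda>(T, Xs, S). card (declared T - Xs), \<lambda>(T, Xs, S). size S]")
  fix T :: decls and Xs m Sm
  assume "m \<notin> Xs" and "map_of T m = Some Sm"
  then have "m \<in> declared T - Xs"
    by (auto dest!: map_of_SomeD intro: rev_image_eqI)
  then have "declared T - insert m Xs \<subset> declared T - Xs"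
    by auto
  then have "card (declared T - insert m Xs) < card (declared T - Xs)"
    by (intro psubset_card_mono) auto
  then show "((T, insert m Xs, Sm), (T, Xs, Call m)) \<in>
      measures [\<lambda>(T, Xs, S). card (declared T - Xs), \<lambda>(T, Xs, S). size S]"
    by simp
qed auto

definition stf :: "decls \<Rightarrow> stmt \<Rightarrow> tform" where
  "stf T S = stf_in T {} S"

definition proc_formula :: "decls \<Rightarrow> pname \<Rightarrow> stmt \<Rightarrow> tform" where
  "proc_formula T m Sm = Mu (proc_rvar m) (stf_in T {m} Sm)"


section \<open>Proof calculus\<close>

type_synonym assertion = "stmt \<times> tform"

definition context_ok :: "assertion set \<Rightarrow> bool" where
  "context_ok \<Gamma> \<longleftrightarrow> finite \<Gamma> \<and> (\<forall>(S, \<phi>) \<in> \<Gamma>. closed \<phi>)"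

definition assumed_procs :: "assertion set \<Rightarrow> pname set" where
  "assumed_procs \<Gamma> = {m. \<exists>\<phi>. (SVar (proc_svar m), \<phi>) \<in> \<Gamma>}"

text \<open>
  Side conditions on finiteness and closedness ensure that every derivable sequent has a finite
  context and only closed formulas. Exchange and contraction are implicit because contexts are
  sets. There is no left rule for disjunction: a hypothesis states an inclusion of trace sets, and
  inclusion in a union does not give inclusion in one of the two sets.
\<close>

inductive derivable :: "decls \<Rightarrow> assertion set \<Rightarrow> stmt \<Rightarrow> tform \<Rightarrow> bool"
  (\<open>_, _ \<turnstile> _ : _\<close> [60, 60, 60, 60] 55)
  for T where
  Skip: "context_ok \<Gamma> \<Longrightarrow> T, \<Gamma> \<turnstile> Skip : Rel IdR"
| Assign: "context_ok \<Gamma> \<Longrightarrow> T, \<Gamma> \<turnstile> Assign x a : Rel (SbR x a)"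
| Seq: "T, \<Gamma> \<turnstile> S1 : \<phi>1 \<Longrightarrow> T, \<Gamma> \<turnstile> S2 : \<phi>2 \<Longrightarrow> T, \<Gamma> \<turnstile> Seq S1 S2 : (\<phi>1 \<frown> \<phi>2)"
| If: "T, \<Gamma> \<turnstile> Seq Skip S1 : Or (Bool (BNot b)) \<phi> \<Longrightarrow>
       T, \<Gamma> \<turnstile> Seq Skip S2 : Or (Bool b) \<phi> \<Longrightarrow>
       T, \<Gamma> \<turnstile> If b S1 S2 : \<phi>"
| Unfold: "closed (Mu X \<phi>) \<Longrightarrow> T, \<Gamma> \<turnstile> S : subst X (Mu X \<phi>) \<phi> \<Longrightarrow> T, \<Gamma> \<turnstile> S : Mu X \<phi>"
| Cons: "T, \<Gamma> \<turnstile> S : \<phi>' \<Longrightarrow> closed \<phi> \<Longrightarrow> entails \<phi>' \<phi> \<Longrightarrow> T, \<Gamma> \<turnstile> S : \<phi>"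
| Call: "(SVar (proc_svar m), \<phi>m) \<notin> \<Gamma> \<Longrightarrow> (m, Sm) \<in> set T \<Longrightarrow>
         T, insert (SVar (proc_svar m), \<phi>m) \<Gamma>
           \<turnstile> subst_calls (insert m (assumed_procs \<Gamma>)) Sm : \<phi>m \<Longrightarrow>
         T, \<Gamma> \<turnstile> Call m : (Rel IdR \<frown> \<phi>m)"
| Axiom: "context_ok \<Gamma> \<Longrightarrow> (S, \<phi>) \<in> \<Gamma> \<Longrightarrow> T, \<Gamma> \<turnstile> S : \<phi>"
| Weaken: "T, \<Gamma> \<turnstile> S : \<phi> \<Longrightarrow> \<Gamma> \<subseteq> \<Gamma>' \<Longrightarrow> context_ok \<Gamma>' \<Longrightarrow> T, \<Gamma>' \<turnstile> S : \<phi>"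
| Cut: "T, \<Gamma> \<turnstile> S' : \<phi>' \<Longrightarrow> T, insert (S', \<phi>') \<Gamma> \<turnstile> S : \<phi> \<Longrightarrow> T, \<Gamma> \<turnstile> S : \<phi>"
| AndL: "T, insert (S', \<phi>1) (insert (S', \<phi>2) \<Gamma>) \<turnstile> S : \<phi> \<Longrightarrow>
         T, insert (S', And \<phi>1 \<phi>2) \<Gamma> \<turnstile> S : \<phi>"
| AndR: "T, \<Gamma> \<turnstile> S : \<phi>1 \<Longrightarrow> T, \<Gamma> \<turnstile> S : \<phi>2 \<Longrightarrow> T, \<Gamma> \<turnstile> S : And \<phi>1 \<phi>2"
| OrR1: "T, \<Gamma> \<turnstile> S : \<phi>1 \<Longrightarrow> closed \<phi>2 \<Longrightarrow> T, \<Gamma> \<turnstile> S : Or \<phi>1 \<phi>2"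
| OrR2: "T, \<Gamma> \<turnstile> S : \<phi>2 \<Longrightarrow> closed \<phi>1 \<Longrightarrow> T, \<Gamma> \<turnstile> S : Or \<phi>1 \<phi>2"

end

theory Submission
  imports Defs
begin

text \<open>Structural induction on \<open>S\<close> with \<Gamma> fixed; procedure bodies are never
  entered and neither \<open>Call\<close> nor \<open>Unfold\<close> is applied. At a call, the
  substitution yields \<open>skip\<close> followed by \<open>Y_m\<close>, and \<open>stf\<close>
  yields \<open>Rel IdR\<close> chopped with exactly the formula that \<Gamma> assumes for
  \<open>Y_m\<close>, so the axiom suffices. The conditional needs an oracle entailment
  (\<open>chop_Id_entails_guarded\<close>). The side conditions on closed formulas rest on
  \<open>fv_stf_in\<close>.\<close>

lemma rec_program_map_of:
  assumes "rec_program S T" "map_of T m = Some Sm"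
  shows "rec_program Sm T"
  using assms unfolding rec_program_def by (force dest: map_of_SomeD)

text \<open>A recursion variable arises only from a call of some \<open>m\<close> in
  \<open>Xs\<close>; any other call extends \<open>Xs\<close> by \<open>m\<close> but binds the new
  variable with \<open>Mu\<close>. The induction follows the recursion of \<open>stf_in\<close>,
  since the body of \<open>m\<close> is not a subterm of the call.\<close>

lemma fv_stf_in:
  "rec_program S T \<Longrightarrow> fv (stf_in T Xs S) \<subseteq> proc_rvar ` Xs"
proof (induction T Xs S rule: stf_in.induct)
  case (5 T Xs m)
  show ?case
  proof (cases "m \<in> Xs")
    case False
    from "5.prems" obtain Sm where Sm: "map_of T m = Some Sm"
      by (cases "map_of T m") (auto simp: rec_program_def map_of_eq_None_iff)
    with "5.IH" False "5.prems" have "fv (stf_in T (insert m Xs) Sm) \<subseteq> proc_rvar ` insert m Xs"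
      by (blast intro: rec_program_map_of)
    with False Sm show ?thesis by auto
  qed auto
qed (auto simp: rec_program_def)

lemma closed_stf: "rec_program S T \<Longrightarrow> closed (stf T S)"
  using fv_stf_in[of S T "{}"] by (simp add: stf_def)

lemma closed_proc_formula:
  "rec_program Sm T \<Longrightarrow> closed (proc_formula T m Sm)"
  using fv_stf_in[of Sm T "{m}"] by (auto simp: proc_formula_def)

lemma context_ok_proc_formulas:
  assumes "rec_program S T"
  shows "context_ok {(SVar (proc_svar m), proc_formula T m Sm) | m Sm. (m, Sm) \<in> set T}"
proof -
  \<comment> \<open>As an image of \<open>set T\<close> the context is visibly finite.\<close>
  have "{(SVar (proc_svar m), proc_formula T m Sm) | m Sm. (m, Sm) \<in> set T} =
      (\<lambda>(m, Sm). (SVar (proc_svar m), proc_formula T m Sm)) ` set T"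
    by auto
  moreover have "rec_program Sm T" if "(m, Sm) \<in> set T" for m Sm
    using assms that unfolding rec_program_def by force
  ultimately show ?thesis
    by (auto simp: context_ok_def closed_proc_formula)
qed

text \<open>Excluded middle for \<open>b\<close> at the first state, which exists because every
  trace of the chop is nonempty. The two shapes fit the premises of the rule \<open>If\<close>, with
  \<psi> as the other branch.\<close>

lemma chop_Id_entails_guarded:
  shows "entails (Rel IdR \<frown> \<phi>)
      (Or (Bool (BNot b)) (Or (And (Bool b) (Rel IdR \<frown> \<phi>)) \<psi>))"
    and "entails (Rel IdR \<frown> \<phi>)
      (Or (Bool b) (Or \<psi> (And (Bool (BNot b)) (Rel IdR \<frown> \<phi>))))"
  by (auto simp: entails_def chop_def Cons_eq_append_conv)

theorem mainTheorem6:
  fixes S :: stmt and T :: decls and \<Gamma> :: "assertion set"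
  assumes "rec_program S T"
    and "\<Gamma> = {(SVar (proc_svar m), proc_formula T m Sm) | m Sm. (m, Sm) \<in> set T}"
  shows "T, \<Gamma> \<turnstile> subst_calls (declared T) S : stf T S"
  using assms(1)
proof (induction S)
  case Skip
  show ?case
    using context_ok_proc_formulas[OF Skip] assms(2) by (simp add: stf_def derivable.Skip)
next
  case (Assign x a)
  show ?case
    using context_ok_proc_formulas[OF Assign] assms(2) by (simp add: stf_def derivable.Assign)
next
  case (Seq S1 S2)
  then have "rec_program S1 T" "rec_program S2 T" by (auto simp: rec_program_def)
  with Seq.IH show ?case by (simp add: stf_def derivable.Seq)
next
  case (If b S1 S2)
  then have rec: "rec_program S1 T" "rec_program S2 T" by (auto simp: rec_program_def)
  have skip: "T, \<Gamma> \<turnstile> Skip : Rel IdR"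
    using context_ok_proc_formulas[OF If.prems] assms(2) by (simp add: derivable.Skip)
  have closed: "closed (stf T S1)" "closed (stf T S2)"
    using rec by (simp_all add: closed_stf)
  have stf: "stf T (If b S1 S2) = Or (And (Bool b) (Rel IdR \<frown> stf T S1))
      (And (Bool (BNot b)) (Rel IdR \<frown> stf T S2))"
    by (simp add: stf_def)
  show ?case unfolding stf subst_calls.simps
  proof (rule derivable.If)
    show "T, \<Gamma> \<turnstile> Seq Skip (subst_calls (declared T) S1) : Or (Bool (BNot b))
        (Or (And (Bool b) (Rel IdR \<frown> stf T S1)) (And (Bool (BNot b)) (Rel IdR \<frown> stf T S2)))"
      by (rule derivable.Cons[OF derivable.Seq[OF skip If.IH(1)[OF rec(1)]]])
        (use closed in \<open>simp_all add: chop_Id_entails_guarded\<close>)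
    show "T, \<Gamma> \<turnstile> Seq Skip (subst_calls (declared T) S2) : Or (Bool b)
        (Or (And (Bool b) (Rel IdR \<frown> stf T S1)) (And (Bool (BNot b)) (Rel IdR \<frown> stf T S2)))"
      by (rule derivable.Cons[OF derivable.Seq[OF skip If.IH(2)[OF rec(2)]]])
        (use closed in \<open>simp_all add: chop_Id_entails_guarded\<close>)
  qed
next
  case (Call m)
  have ok: "context_ok \<Gamma>"
    using context_ok_proc_formulas[OF Call] assms(2) by simp
  from Call have m: "m \<in> declared T" by (simp add: rec_program_def)
  then obtain Sm where Sm: "map_of T m = Some Sm"
    by (cases "map_of T m") (auto simp: map_of_eq_None_iff)
  then have "(SVar (proc_svar m), proc_formula T m Sm) \<in> \<Gamma>"
    using assms(2) by (auto dest: map_of_SomeD)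
  \<comment> \<open>Since \<open>stf\<close> starts from the empty set of procedures, it expands
    this call to the chop derived here.\<close>
  with ok have "T, \<Gamma> \<turnstile> Seq Skip (SVar (proc_svar m)) : (Rel IdR \<frown> proc_formula T m Sm)"
    by (intro derivable.Seq derivable.Skip derivable.Axiom)
  with m Sm show ?case by (simp add: stf_def proc_formula_def)
next
  case (SVar Y)
  then show ?case by (simp add: rec_program_def)
qed

end
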